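(* Let $\tau\in[0,T]$, $\alpha\in\mathbb{R}$, and let $\Theta_\tau$ be the frozen terminal-time transform. Then for $n=2,3$ and every $g\in C(\Delta_T^n;B_\alpha)$, $$\delta(\Theta_\tau g)=\Theta_\tau(\hat\delta g)\quad\text{on }\Delta_\tau^{n+1}.$$
   Context: Fix $T>0$. $(B_\alpha)_{\alpha\in\mathbb{R}}$ is a Banach scale, i.e. a family of Banach spaces such that for $\alpha\le\beta$ the embedding $B_\beta\hookrightarrow B_\alpha$ is continuous. $S=(S_t)_{t\ge0}$ is an analytic (in particular strongly continuous) semigroup of bounded linear operators acting on this scale, with $S_0=\mathrm{Id}$; for every $\alpha\in\mathbb{R}$, $\varepsilon\in(0,1)$ there is $C_{\alpha,\varepsilon,T}>0$ with $\|S_tx\|_{B_{\alpha+\varepsilon}}\le C_{\alpha,\varepsilon,T}t^{-\varepsilon}\|x\|_{B_\alpha}$ and $\|(S_t-\mathrm{Id})x\|_{B_\alpha}\le C_{\alpha,\varepsilon,T}t^{\varepsilon}\|x\|_{B_{\alpha+\varepsilon}}$ for all $t\in(0,T]$. For $\tau\in[0,T]$ and $n\ge1$, $\Delta_\tau^n:=\{(t_1,\dots,t_n)\in[0,\tau]^n: 0\le t_n\le\dots\le t_1\le\tau\}$; $C(\Delta_\tau^n;B_\alpha)$ is the space of continuous maps $\Delta_\tau^n\to B_\alpha$. The coboundary is $(\delta g)_{t_1\dots t_{n+1}}:=\sum_{i=1}^{n+1}(-1)^i g_{t_1\dots\hat t_i\dots t_{n+1}}$ ($\hat t_i$ omitted).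 With $a_{ts}:=S_{t-s}-\mathrm{Id}$ and $(ag)_{t_1\dots t_{n+1}}:=a_{t_1t_2}g_{t_2\dots t_{n+1}}$, set $\hat\delta:=\delta-a$ on $C(\Delta_T^n;B_\alpha)$. For $n\ge2$ the frozen terminal-time transform $\Theta_\tau:C(\Delta_T^n;B_\alpha)\to C(\Delta_\tau^n;B_\alpha)$ is $(\Theta_\tau g)_{t_1\dots t_n}:=S_{\tau-t_1}g_{t_1\dots t_n}$ for $(t_1,\dots,t_n)\in\Delta_\tau^n$. *)

theory Defs
  imports "HOL-Analysis.Analysis"
begin

(* The spaces B alpha are linear subspaces of one ambient real vector space, each with its own
   norm, so that the embeddings of the scale are inclusions (the ambient space can always be
   taken to be the union of the scale).  The norm N is only constrained on the carrier V.
   Complex Banach spaces are covered through their underlying real structure. *)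

(* Metric_space requires symmetry and nonnegativity also off the carrier, hence the value 0. *)
definition norm_dist :: "'a::real_vector set \<Rightarrow> ('a \<Rightarrow> real) \<Rightarrow> 'a \<Rightarrow> 'a \<Rightarrow> real" where
  "norm_dist V N x y = (if x \<in> V \<and> y \<in> V then N (x - y) else 0)"

definition banach_space_on :: "'a::real_vector set \<Rightarrow> ('a \<Rightarrow> real) \<Rightarrow> bool" where
  "banach_space_on V N \<longleftrightarrow>
     subspace V \<and>
     (\<forall>x\<in>V. 0 \<le> N x) \<and>
     (\<forall>x\<in>V. N x = 0 \<longleftrightarrow> x = 0) \<and>
     (\<forall>x\<in>V. \<forall>c. N (c *\<^sub>R x) = \<bar>c\<bar> * N x) \<and>
     (\<forall>x\<in>V. \<forall>y\<in>V. N (x + y) \<le> N x + N y) \<and>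
     Metric_space.mcomplete V (norm_dist V N)"

definition norm_topology :: "'a::real_vector set \<Rightarrow> ('a \<Rightarrow> real) \<Rightarrow> 'a topology" where
  "norm_topology V N = Metric_space.mtopology V (norm_dist V N)"

definition banach_scale :: "(real \<Rightarrow> 'a::real_vector set) \<Rightarrow> (real \<Rightarrow> 'a \<Rightarrow> real) \<Rightarrow> bool" where
  "banach_scale B N \<longleftrightarrow>
     (\<forall>\<alpha>. banach_space_on (B \<alpha>) (N \<alpha>)) \<and>
     (\<forall>\<alpha> \<beta>. \<alpha> \<le> \<beta> \<longrightarrow> B \<beta> \<subseteq> B \<alpha> \<and>
        continuous_map (norm_topology (B \<beta>) (N \<beta>)) (norm_topology (B \<alpha>) (N \<alpha>)) (\<lambda>x. x))"

definition bounded_operator_on ::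
    "'a::real_vector set \<Rightarrow> ('a \<Rightarrow> real) \<Rightarrow> ('a \<Rightarrow> 'a) \<Rightarrow> bool" where
  "bounded_operator_on V N f \<longleftrightarrow>
     f \<in> V \<rightarrow> V \<and>
     (\<forall>x\<in>V. \<forall>y\<in>V. f (x + y) = f x + f y) \<and>
     (\<forall>x\<in>V. \<forall>c. f (c *\<^sub>R x) = c *\<^sub>R f x) \<and>
     (\<exists>K. \<forall>x\<in>V. N (f x) \<le> K * N x)"

definition c0_semigroup_on ::
    "'a::real_vector set \<Rightarrow> ('a \<Rightarrow> real) \<Rightarrow> (real \<Rightarrow> 'a \<Rightarrow> 'a) \<Rightarrow> bool" where
  "c0_semigroup_on V N S \<longleftrightarrow>
     (\<forall>t\<ge>0. bounded_operator_on V N (S t)) \<and>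
     (\<forall>x\<in>V. S 0 x = x) \<and>
     (\<forall>s\<ge>0. \<forall>t\<ge>0. \<forall>x\<in>V. S (s + t) x = S s (S t x)) \<and>
     (\<forall>x\<in>V. continuous_map (top_of_set {0..}) (norm_topology V N) (\<lambda>t. S t x))"

(* Analyticity refers to the complexification V \<times> V of V, where (x, y) stands for x + i y.
   The norm cnorm is not homogeneous for complex scalars, but it is equivalent to every
   admissible norm on the complexification; boundedness, limits and complex
   differentiability do not depend on this choice. *)

definition cscale :: "complex \<Rightarrow> 'a::real_vector \<times> 'a \<Rightarrow> 'a \<times> 'a" where
  "cscale c w = (Re c *\<^sub>R fst w - Im c *\<^sub>R snd w, Re c *\<^sub>R snd w + Im c *\<^sub>R fst w)"

definition cnorm :: "('a \<Rightarrow> real) \<Rightarrow> 'a \<times> 'a \<Rightarrow> real" where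
  "cnorm N w = N (fst w) + N (snd w)"

definition complex_operator_on ::
    "'a::real_vector set \<Rightarrow> ('a \<Rightarrow> real) \<Rightarrow> ('a \<times> 'a \<Rightarrow> 'a \<times> 'a) \<Rightarrow> bool" where
  "complex_operator_on V N f \<longleftrightarrow>
     bounded_operator_on (V \<times> V) (cnorm N) f \<and>
     (\<forall>w\<in>V \<times> V. \<forall>c. f (cscale c w) = cscale c (f w))"

definition sector :: "real \<Rightarrow> complex set" where
  "sector \<theta> = {z. z \<noteq> 0 \<and> \<bar>Arg z\<bar> < \<theta>}"

(* Differentiability in the operator norm: the last inequality says that the operator norm of
   F (z + h) - F z - h D is at most e |h|. *)

definition operator_holomorphic_on ::
    "'a::real_vector set \<Rightarrow> ('a \<Rightarrow> real) \<Rightarrow> (complex \<Rightarrow> 'a \<times> 'a \<Rightarrow> 'a \<times> 'a) \<Rightarrow> complex set \<Rightarrow> bool" where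
  "operator_holomorphic_on V N F Z \<longleftrightarrow>
     (\<forall>z\<in>Z. \<exists>D. complex_operator_on V N D \<and>
       (\<forall>e>0. \<exists>d>0. \<forall>h. cmod h < d \<and> z + h \<in> Z \<longrightarrow>
         (\<forall>w\<in>V \<times> V. cnorm N (F (z + h) w - F z w - cscale h (D w)) \<le> e * cmod h * cnorm N w)))"

definition analytic_semigroup_on ::
    "'a::real_vector set \<Rightarrow> ('a \<Rightarrow> real) \<Rightarrow> (real \<Rightarrow> 'a \<Rightarrow> 'a) \<Rightarrow> bool" where
  "analytic_semigroup_on V N S \<longleftrightarrow>
     c0_semigroup_on V N S \<and>
     (\<exists>\<theta> F. 0 < \<theta> \<and> \<theta> \<le> pi / 2 \<and>
        (\<forall>z\<in>sector \<theta>. complex_operator_on V N (F z)) \<and>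
        (\<forall>t>0. \<forall>x\<in>V. F (complex_of_real t) (x, 0) = (S t x, 0)) \<and>
        (\<forall>z\<in>sector \<theta>. \<forall>z'\<in>sector \<theta>. \<forall>w\<in>V \<times> V. F (z + z') w = F z (F z' w)) \<and>
        operator_holomorphic_on V N F (sector \<theta>) \<and>
        (\<forall>\<theta>'. 0 < \<theta>' \<and> \<theta>' < \<theta> \<longrightarrow>
           (\<forall>w\<in>V \<times> V. ((\<lambda>z. cnorm N (F z w - w)) \<longlongrightarrow> 0) (at 0 within sector \<theta>'))))"

definition analytic_semigroup_on_scale ::
    "real \<Rightarrow> (real \<Rightarrow> 'a::real_vector set) \<Rightarrow> (real \<Rightarrow> 'a \<Rightarrow> real) \<Rightarrow> (real \<Rightarrow> 'a \<Rightarrow> 'a) \<Rightarrow> bool" where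
  "analytic_semigroup_on_scale T B N S \<longleftrightarrow>
     (\<forall>\<alpha>. analytic_semigroup_on (B \<alpha>) (N \<alpha>) S) \<and>
     (\<forall>\<alpha> \<epsilon>. 0 < \<epsilon> \<and> \<epsilon> < 1 \<longrightarrow>
       (\<exists>C>0. \<forall>t. 0 < t \<and> t \<le> T \<longrightarrow>
          (\<forall>x\<in>B \<alpha>. S t x \<in> B (\<alpha> + \<epsilon>) \<and> N (\<alpha> + \<epsilon>) (S t x) \<le> C * t powr (-\<epsilon>) * N \<alpha> x) \<and>
          (\<forall>x\<in>B (\<alpha> + \<epsilon>). N \<alpha> (S t x - x) \<le> C * t powr \<epsilon> * N (\<alpha> + \<epsilon>) x)))"

(* An n-tuple (t_1, ..., t_n) is a function on {1..n}, extended by undefined. *)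

definition time_simplex :: "real \<Rightarrow> nat \<Rightarrow> (nat \<Rightarrow> real) set" where
  "time_simplex \<tau> n = {t \<in> {1..n} \<rightarrow>\<^sub>E {0..\<tau>}. \<forall>i\<in>{1..<n}. t (Suc i) \<le> t i}"

definition simplex_maps ::
    "real \<Rightarrow> nat \<Rightarrow> 'a::real_vector set \<Rightarrow> ('a \<Rightarrow> real) \<Rightarrow> ((nat \<Rightarrow> real) \<Rightarrow> 'a) set" where
  "simplex_maps \<tau> n V N =
     {g. continuous_map (subtopology (powertop_real {1..n}) (time_simplex \<tau> n)) (norm_topology V N) g}"

(* The n-tuple obtained from an (n+1)-tuple t by omitting t_i. *)

definition omit :: "nat \<Rightarrow> nat \<Rightarrow> (nat \<Rightarrow> real) \<Rightarrow> nat \<Rightarrow> real" where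
  "omit n i t = restrict (\<lambda>j. if j < i then t j else t (Suc j)) {1..n}"

(* The argument n below is the number of time variables of g; the results have n + 1. *)

definition coboundary :: "nat \<Rightarrow> ((nat \<Rightarrow> real) \<Rightarrow> 'a::real_vector) \<Rightarrow> (nat \<Rightarrow> real) \<Rightarrow> 'a" where
  "coboundary n g t = (\<Sum>i=1..n+1. (-1) ^ i *\<^sub>R g (omit n i t))"

definition semigroup_increment :: "(real \<Rightarrow> 'a::real_vector \<Rightarrow> 'a) \<Rightarrow> real \<Rightarrow> real \<Rightarrow> 'a \<Rightarrow> 'a" where
  "semigroup_increment S t s x = S (t - s) x - x"

definition increment_action ::
    "(real \<Rightarrow> 'a::real_vector \<Rightarrow> 'a) \<Rightarrow> nat \<Rightarrow> ((nat \<Rightarrow> real) \<Rightarrow> 'a) \<Rightarrow> (nat \<Rightarrow> real) \<Rightarrow> 'a" where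
  "increment_action S n g t = semigroup_increment S (t 1) (t 2) (g (omit n 1 t))"

definition twisted_coboundary ::
    "(real \<Rightarrow> 'a::real_vector \<Rightarrow> 'a) \<Rightarrow> nat \<Rightarrow> ((nat \<Rightarrow> real) \<Rightarrow> 'a) \<Rightarrow> (nat \<Rightarrow> real) \<Rightarrow> 'a" where
  "twisted_coboundary S n g t = coboundary n g t - increment_action S n g t"

definition frozen_transform ::
    "(real \<Rightarrow> 'a::real_vector \<Rightarrow> 'a) \<Rightarrow> real \<Rightarrow> ((nat \<Rightarrow> real) \<Rightarrow> 'a) \<Rightarrow> (nat \<Rightarrow> real) \<Rightarrow> 'a" where
  "frozen_transform S \<tau> g t = S (\<tau> - t 1) (g t)"

end

theory Submission
  imports Defs
begin

text \<open>
  In the coboundary, every face \<open>t_1, ..., t_{i-1}, t_{i+1}, ...\<close> with \<open>i \<ge> 2\<close> keeps the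
  first time \<open>t_1\<close>; only the face that omits \<open>t_1\<close> starts at the earlier time \<open>t_2\<close>.
  Accordingly the transform propagates all faces with \<open>i \<ge> 2\<close> by the same operator
  \<open>S (\<tau> - t_1)\<close>, which linearity pulls out of the sum, while the exceptional face
  carries \<open>S (\<tau> - t_2) = S (\<tau> - t_1) S (t_1 - t_2)\<close>.  The twist by the increment is
  designed for exactly this: subtracting \<open>(S (t_1 - t_2) - Id) g\<close> from the coboundary turns its first term
  \<open>- g\<close> into \<open>- S (t_1 - t_2) g\<close> (lemma \<open>twisted_coboundary_split_first_face\<close>).

  The argument is algebraic and works for every \<open>n \<ge> 1\<close>
  (lemma \<open>coboundary_frozen_transform\<close>).  Since the operators are linear only on the carrier
  \<open>B \<alpha>\<close>, the values of \<open>g\<close> at all faces must lie there; this is where the simplices and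
  the topology enter.
\<close>

section \<open>Values of simplex maps at the faces of a simplex\<close>

text \<open>
  The abstract topology of a metric is only known to live on its carrier once the metric axioms
  hold, so these have to be derived from the norm axioms.
\<close>

lemma Metric_space_norm_dist:
  assumes "banach_space_on V N"
  shows "Metric_space V (norm_dist V N)"
proof -
  have V: "subspace V"
    and nonneg: "\<And>x. x \<in> V \<Longrightarrow> 0 \<le> N x"
    and zero: "\<And>x. x \<in> V \<Longrightarrow> N x = 0 \<longleftrightarrow> x = 0"
    and scale: "\<And>x c. x \<in> V \<Longrightarrow> N (c *\<^sub>R x) = \<bar>c\<bar> * N x"
    and triangle: "\<And>x y. \<lbrakk>x \<in> V; y \<in> V\<rbrakk> \<Longrightarrow> N (x + y) \<le> N x + N y"
    using assms by (auto simp: banach_space_on_def)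
  show ?thesis
  proof
    show "0 \<le> norm_dist V N x y" for x y
      using V nonneg by (simp add: norm_dist_def subspace_diff)
  next
    show "norm_dist V N x y = norm_dist V N y x" for x y
      using scale[of "x - y" "-1"] V by (simp add: norm_dist_def subspace_diff)
  next
    fix x y assume "x \<in> V" "y \<in> V"
    then show "norm_dist V N x y = 0 \<longleftrightarrow> x = y"
      using V zero by (simp add: norm_dist_def subspace_diff)
  next
    fix x y z assume "x \<in> V" "y \<in> V" "z \<in> V"
    then show "norm_dist V N x z \<le> norm_dist V N x y + norm_dist V N y z"
      using V triangle[of "x - y" "y - z"] by (simp add: norm_dist_def subspace_diff)
  qed
qed

lemma topspace_norm_topology:
  assumes "banach_space_on V N"
  shows "topspace (norm_topology V N) = V"
  unfolding norm_topology_def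
  by (rule Metric_space.topspace_mtopology[OF Metric_space_norm_dist[OF assms]])

lemma simplex_maps_in_carrier:
  assumes "banach_space_on V N" "g \<in> simplex_maps \<tau> n V N" "t \<in> time_simplex \<tau> n"
  shows "g t \<in> V"
proof -
  have "t \<in> topspace (subtopology (powertop_real {1..n}) (time_simplex \<tau> n))"
    using assms(3) by (auto simp: time_simplex_def PiE_iff)
  moreover have "continuous_map (subtopology (powertop_real {1..n}) (time_simplex \<tau> n))
      (norm_topology V N) g"
    using assms(2) by (simp add: simplex_maps_def)
  ultimately show ?thesis
    using topspace_norm_topology[OF assms(1)] by (auto simp: continuous_map_def)
qed

lemma omit_in_time_simplex:
  assumes "t \<in> time_simplex \<tau> (n + 1)" "\<tau> \<le> T"
  shows "omit n i t \<in> time_simplex T n"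
proof -
  have "t \<in> {1..n + 1} \<rightarrow>\<^sub>E {0..\<tau>}"
    using assms(1) by (simp add: time_simplex_def)
  then have "t j \<in> {0..\<tau>}" if "j \<in> {1..n + 1}" for j
    using that by (rule PiE_mem)
  then have range: "t j \<in> {0..T}" if "j \<in> {1..n + 1}" for j
    using that assms(2) by fastforce
  have step: "t (Suc j) \<le> t j" if "j \<in> {1..<n + 1}" for j
    using assms(1) that unfolding time_simplex_def by blast
  have "omit n i t (Suc j) \<le> omit n i t j" if j: "j \<in> {1..<n}" for j
  proof -
    have "t (Suc j) \<le> t j" "t (Suc (Suc j)) \<le> t (Suc j)"
      using step[of j] step[of "Suc j"] j by auto
    then show ?thesis using j by (auto simp: omit_def)
  qed
  moreover have "omit n i t j \<in> {0..T}" if j: "j \<in> {1..n}" for j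
    using range[of j] range[of "Suc j"] j by (auto simp: omit_def)
  moreover have "omit n i t j = undefined" if "j \<notin> {1..n}" for j
    using that by (simp only: omit_def restrict_apply if_False)
  ultimately show ?thesis
    unfolding time_simplex_def by blast
qed

section \<open>The intertwining identity\<close>

lemma bounded_operator_on_diff:
  assumes f: "bounded_operator_on V N f" and V: "subspace V" and x: "x \<in> V" and y: "y \<in> V"
  shows "f (x - y) = f x - f y"
proof -
  have "f (x + (-1) *\<^sub>R y) = f x + (-1) *\<^sub>R f y"
    using f x y subspace_scale[OF V y, of "-1"] unfolding bounded_operator_on_def by metis
  then show ?thesis by simp
qed

lemma bounded_operator_on_sum:
  assumes f: "bounded_operator_on V N f" and V: "subspace V"
    and "finite I" "\<And>i. i \<in> I \<Longrightarrow> x i \<in> V"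
  shows "f (\<Sum>i\<in>I. c i *\<^sub>R x i) = (\<Sum>i\<in>I. c i *\<^sub>R f (x i))"
  using assms(3,4)
proof (induction I rule: finite_induct)
  case empty
  have "f (0 *\<^sub>R 0) = 0 *\<^sub>R f 0"
    using f subspace_0[OF V] unfolding bounded_operator_on_def by blast
  then show ?case by simp
next
  case (insert i I)
  have "c i *\<^sub>R x i \<in> V" "(\<Sum>i\<in>I. c i *\<^sub>R x i) \<in> V"
    using insert.prems by (auto intro!: subspace_sum subspace_scale V)
  then show ?case
    using f insert by (simp add: bounded_operator_on_def)
qed

lemma coboundary_split_first_face:
  "coboundary n g t = (\<Sum>i=2..n+1. (-1) ^ i *\<^sub>R g (omit n i t)) - g (omit n 1 t)"
proof -
  have "coboundary n g t = (-1) ^ 1 *\<^sub>R g (omit n 1 t)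
      + (\<Sum>i=Suc 1..n+1. (-1) ^ i *\<^sub>R g (omit n i t))"
    unfolding coboundary_def by (rule sum.atLeast_Suc_atMost) simp
  then show ?thesis by (simp add: numeral_2_eq_2)
qed

text \<open>
  The identity part of the increment cancels the first face, so that the twisted coboundary is
  the coboundary with its first face propagated from time \<open>t_2\<close> to time \<open>t_1\<close>.
\<close>

lemma twisted_coboundary_split_first_face:
  "twisted_coboundary S n g t
     = (\<Sum>i=2..n+1. (-1) ^ i *\<^sub>R g (omit n i t)) - S (t 1 - t 2) (g (omit n 1 t))"
  by (simp add: twisted_coboundary_def coboundary_split_first_face increment_action_def
      semigroup_increment_def)

text \<open>
  The semigroup law matches the first faces, and linearity on \<open>V\<close> the remaining sums.  The
  lower bound on \<open>n\<close> makes the first coordinate of a face meaningful: it is \<open>t_2\<close> for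
  the first face and \<open>t_1\<close> for all others.
\<close>

lemma coboundary_frozen_transform:
  assumes S: "c0_semigroup_on V N S" and V: "subspace V" and n: "n \<ge> 1"
    and t: "t \<in> time_simplex \<tau> (n + 1)"
    and g: "\<And>i. g (omit n i t) \<in> V"
  shows "coboundary n (frozen_transform S \<tau> g) t
           = frozen_transform S \<tau> (twisted_coboundary S n g) t"
proof -
  have "t \<in> {1..n + 1} \<rightarrow>\<^sub>E {0..\<tau>}" "\<forall>i\<in>{1..<n + 1}. t (Suc i) \<le> t i"
    using t by (simp_all add: time_simplex_def)
  then have "t 1 \<in> {0..\<tau>}" "t (Suc 1) \<le> t 1"
    using n PiE_mem[of t "{1..n + 1}" "\<lambda>_. {0..\<tau>}" 1] by (simp_all only: Ball_def) simp_all
  then have times: "0 \<le> \<tau> - t 1" "0 \<le> t 1 - t 2"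
    by (simp_all add: numeral_2_eq_2)
  define L where "L = S (\<tau> - t 1)"
  define x where "x i = g (omit n i t)" for i
  define y where "y = S (t 1 - t 2) (x 1)"
  have L: "bounded_operator_on V N L"
    using S times by (simp add: L_def c0_semigroup_on_def)
  have x: "x i \<in> V" for i
    using g by (simp add: x_def)
  have y: "y \<in> V"
    using S times x[of 1] unfolding y_def c0_semigroup_on_def bounded_operator_on_def by blast
  have first: "S (\<tau> - t 2) (x 1) = L y"
  proof -
    have "S ((\<tau> - t 1) + (t 1 - t 2)) (x 1) = S (\<tau> - t 1) (S (t 1 - t 2) (x 1))"
      using S times x[of 1] unfolding c0_semigroup_on_def by blast
    then show ?thesis by (simp add: L_def y_def)
  qed
  have face_first: "frozen_transform S \<tau> g (omit n 1 t) = S (\<tau> - t 2) (x 1)"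
    using n by (simp add: frozen_transform_def omit_def x_def numeral_2_eq_2)
  have face_later: "frozen_transform S \<tau> g (omit n i t) = L (x i)" if "i \<in> {2..n+1}" for i
  proof -
    have "omit n i t 1 = t 1"
      unfolding omit_def using n that by (subst restrict_apply', auto)
    then show ?thesis by (simp only: frozen_transform_def x_def L_def)
  qed
  have "coboundary n (frozen_transform S \<tau> g) t = (\<Sum>i=2..n+1. (-1) ^ i *\<^sub>R L (x i)) - L y"
    unfolding coboundary_split_first_face face_first first
    using face_later by (intro arg_cong2[of _ _ _ _ minus] sum.cong) auto
  also have "\<dots> = L (\<Sum>i=2..n+1. (-1) ^ i *\<^sub>R x i) - L y"
    by (subst bounded_operator_on_sum[OF L V]) (auto simp: x)
  also have "\<dots> = L ((\<Sum>i=2..n+1. (-1) ^ i *\<^sub>R x i) - y)"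
    by (rule bounded_operator_on_diff[OF L V _ y, symmetric])
      (intro subspace_sum subspace_scale V x)
  also have "\<dots> = frozen_transform S \<tau> (twisted_coboundary S n g) t"
    by (simp add: frozen_transform_def twisted_coboundary_split_first_face L_def x_def y_def)
  finally show ?thesis .
qed

theorem proposition3p2:
  fixes T \<tau> \<alpha> :: real
    and B :: "real \<Rightarrow> 'a::real_vector set"
    and N :: "real \<Rightarrow> 'a \<Rightarrow> real"
    and S :: "real \<Rightarrow> 'a \<Rightarrow> 'a"
    and n :: nat
    and g :: "(nat \<Rightarrow> real) \<Rightarrow> 'a"
  assumes "T > 0"
    and "banach_scale B N"
    and "analytic_semigroup_on_scale T B N S"
    and "\<tau> \<in> {0..T}"
    and "n \<in> {2, 3}"
    and "g \<in> simplex_maps T n (B \<alpha>) (N \<alpha>)"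
  shows "\<forall>t \<in> time_simplex \<tau> (n + 1).
           coboundary n (frozen_transform S \<tau> g) t
             = frozen_transform S \<tau> (twisted_coboundary S n g) t"
proof
  fix t assume t: "t \<in> time_simplex \<tau> (n + 1)"
  have B: "banach_space_on (B \<alpha>) (N \<alpha>)"
    using assms(2) by (simp add: banach_scale_def)
  show "coboundary n (frozen_transform S \<tau> g) t
          = frozen_transform S \<tau> (twisted_coboundary S n g) t"
  proof (rule coboundary_frozen_transform[OF _ _ _ t])
    show "c0_semigroup_on (B \<alpha>) (N \<alpha>) S"
      using assms(3) by (simp add: analytic_semigroup_on_scale_def analytic_semigroup_on_def)
    show "subspace (B \<alpha>)"
      using B by (simp add: banach_space_on_def)
    show "n \<ge> 1"
      using assms(5) by auto
    show "g (omit n i t) \<in> B \<alpha>" for i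
      using simplex_maps_in_carrier[OF B assms(6) omit_in_time_simplex[OF t]] assms(4) by simp
  qed
qed

end
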